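(* Let $g>0$, $\Omega>0$, $\rho_0>0$, $d>0$, $\mu>0$, and consider the density $\rho(x)=\rho_0+\mu\delta(x-d)-\mu\delta(x+d)$. Let $\lambda(\omega)=\omega-\frac{g^2\rho_0}{\omega-\Omega}$, $\omega_\pm=\frac12\left(\Omega\pm\sqrt{\Omega^2+4g^2\rho_0}\right)$, $G_-=(-\infty,\omega_-)$, $G_+=(\Omega,\omega_+)$, and $\kappa(\omega)=\sqrt{-\lambda(\omega)}$ for $\omega\in G_-\cup G_+$. A real number $\omega\ne\Omega$ is an eigenvalue if and only if $\omega\in G_-\cup G_+$ and $$\mu=\frac{2\kappa(\omega)\,|\omega-\Omega|}{g^2\sqrt{1-e^{-4\kappa(\omega)d}}}.$$ Moreover, for every $\mu>0$ there is exactly one eigenvalue in $G_-$, and the number of eigenvalues in $G_+$ is $0$, $1$ or $2$.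
   Context: Write $\mu_{+}=\mu$ and $\mu_-=-\mu$ for the strengths at $x=+d$ and $x=-d$. A real $\omega\neq\Omega$ is called an eigenvalue (bound-state frequency) for this density if the problem $-\psi''+\frac{g^2}{\omega-\Omega}\left(\mu_+\delta(x-d)+\mu_-\delta(x+d)\right)\psi=\lambda(\omega)\psi$ has a nonzero solution $\psi\in L^2(\mathbb{R})$. This means: $\psi$ is continuous on $\mathbb{R}$, $-\psi''=\lambda(\omega)\psi$ on $\mathbb{R}\setminus\{-d,d\}$, and the one-sided derivatives at $\pm d$ exist and satisfy $-\psi'(d^+)+\psi'(d^-)+\frac{g^2\mu_+}{\omega-\Omega}\psi(d)=0$ and $-\psi'(-d^+)+\psi'(-d^-)+\frac{g^2\mu_-}{\omega-\Omega}\psi(-d)=0$, where $\psi'(\pm d^{+})$ and $\psi'(\pm d^-)$ denote right and left derivatives at $\pm d$. Eigenvalues are counted as distinct values of $\omega$. *)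

theory Defs
  imports "HOL-Analysis.Analysis"
begin

definition lam :: "real \<Rightarrow> real \<Rightarrow> real \<Rightarrow> real \<Rightarrow> real" where
  "lam g \<Omega> \<rho>\<^sub>0 \<omega> = \<omega> - g\<^sup>2 * \<rho>\<^sub>0 / (\<omega> - \<Omega>)"

definition omega_plus :: "real \<Rightarrow> real \<Rightarrow> real \<Rightarrow> real" where
  "omega_plus g \<Omega> \<rho>\<^sub>0 = (\<Omega> + sqrt (\<Omega>\<^sup>2 + 4 * g\<^sup>2 * \<rho>\<^sub>0)) / 2"

definition omega_minus :: "real \<Rightarrow> real \<Rightarrow> real \<Rightarrow> real" where
  "omega_minus g \<Omega> \<rho>\<^sub>0 = (\<Omega> - sqrt (\<Omega>\<^sup>2 + 4 * g\<^sup>2 * \<rho>\<^sub>0)) / 2"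

definition G_minus :: "real \<Rightarrow> real \<Rightarrow> real \<Rightarrow> real set" where
  "G_minus g \<Omega> \<rho>\<^sub>0 = {..<omega_minus g \<Omega> \<rho>\<^sub>0}"

definition G_plus :: "real \<Rightarrow> real \<Rightarrow> real \<Rightarrow> real set" where
  "G_plus g \<Omega> \<rho>\<^sub>0 = {\<Omega><..<omega_plus g \<Omega> \<rho>\<^sub>0}"

definition kappa :: "real \<Rightarrow> real \<Rightarrow> real \<Rightarrow> real \<Rightarrow> real" where
  "kappa g \<Omega> \<rho>\<^sub>0 \<omega> = sqrt (- lam g \<Omega> \<rho>\<^sub>0 \<omega>)"

definition square_integrable :: "(real \<Rightarrow> complex) \<Rightarrow> bool" where
  "square_integrable \<psi> \<longleftrightarrow>
     \<psi> \<in> borel_measurable lborel \<and> integrable lborel (\<lambda>x. (norm (\<psi> x))\<^sup>2)"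

text \<open>The differential equation is understood classically: off the set \<open>S\<close>, \<open>\<psi>\<close> is twice
  differentiable, with first derivative \<open>\<psi>1\<close> and second derivative \<open>\<psi>2\<close>.\<close>

definition helmholtz_off :: "real set \<Rightarrow> real \<Rightarrow> (real \<Rightarrow> complex) \<Rightarrow> bool" where
  "helmholtz_off S l \<psi> \<longleftrightarrow>
     (\<exists>\<psi>1 \<psi>2. \<forall>x\<in>- S. (\<psi> has_vector_derivative \<psi>1 x) (at x) \<and>
                       (\<psi>1 has_vector_derivative \<psi>2 x) (at x) \<and>
                       - \<psi>2 x = complex_of_real l * \<psi> x)"

text \<open>The matching condition at \<open>a\<close> encoding the interaction \<open>c \<delta>(x - a)\<close>; \<open>r\<close> and \<open>l\<close> are the
  right and left derivatives of \<open>\<psi>\<close> at \<open>a\<close>.\<close>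

definition delta_condition :: "real \<Rightarrow> real \<Rightarrow> (real \<Rightarrow> complex) \<Rightarrow> bool" where
  "delta_condition a c \<psi> \<longleftrightarrow>
     (\<exists>r l. (\<psi> has_vector_derivative r) (at_right a) \<and>
            (\<psi> has_vector_derivative l) (at_left a) \<and>
            - r + l + complex_of_real c * \<psi> a = 0)"

text \<open>Solutions of the two-delta problem with strength \<open>\<mu>p\<close> at \<open>d\<close> and \<open>\<mu>m\<close> at \<open>-d\<close>.\<close>

definition two_delta_solution ::
  "real \<Rightarrow> real \<Rightarrow> real \<Rightarrow> real \<Rightarrow> real \<Rightarrow> real \<Rightarrow> real \<Rightarrow> (real \<Rightarrow> complex) \<Rightarrow> bool" where
  "two_delta_solution g \<Omega> \<rho>\<^sub>0 d \<mu>p \<mu>m \<omega> \<psi> \<longleftrightarrow>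
     continuous_on UNIV \<psi> \<and>
     helmholtz_off {- d, d} (lam g \<Omega> \<rho>\<^sub>0 \<omega>) \<psi> \<and>
     delta_condition d (g\<^sup>2 * \<mu>p / (\<omega> - \<Omega>)) \<psi> \<and>
     delta_condition (- d) (g\<^sup>2 * \<mu>m / (\<omega> - \<Omega>)) \<psi>"

definition is_eigenvalue :: "real \<Rightarrow> real \<Rightarrow> real \<Rightarrow> real \<Rightarrow> real \<Rightarrow> real \<Rightarrow> bool" where
  "is_eigenvalue g \<Omega> \<rho>\<^sub>0 d \<mu> \<omega> \<longleftrightarrow>
     \<omega> \<noteq> \<Omega> \<and>
     (\<exists>\<psi>. square_integrable \<psi> \<and> (\<exists>x. \<psi> x \<noteq> 0) \<and>
          two_delta_solution g \<Omega> \<rho>\<^sub>0 d \<mu> (- \<mu>) \<omega> \<psi>)"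

end

(* For lambda >= 0 no nonzero solution is square integrable at infinity, so a bound state vanishes outside
   [-d, d], has zero Cauchy data at -d by the jump condition, and is zero. For lambda < 0 the exponential
   solutions on the three intervals match iff 4 kappa^2 = c^2 (1 - exp (-4 kappa d)), where
   c = g^2 mu / (omega - Omega); a solution is then a combination of exp (- kappa |x - d|) and
   exp (- kappa |x + d|).

   To count eigenvalues, use kappa in (0, infinity) as a coordinate on G_- and on G_+. On G_- the required
   coupling increases from 0 to infinity. On G_+ three eigenvalues would give, by Rolle, two critical points
   of its logarithm. *)

theory Submission
  imports Defs "HOL-Real_Asymp.Real_Asymp"
begin

section \<open>Bound states and the secular equation\<close>

text \<open>Up to the factor 2 / g^2, the coupling required at \<omega> is a weight in \<kappa>
  alone times |\<omega> - \<Omega>|. The weight is the same increasing function on both bands. The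
  distance |\<omega> - \<Omega>| is the positive root of a quadratic whose linear coefficient has
  opposite signs on the two bands, so it grows with \<kappa> on G_- and shrinks on G_+. On G_+ the
  two factors therefore compete. Comparing their logarithmic derivatives over all \<kappa> is not
  enough, because the rate of decay of the distance is itself not monotone: it vanishes at 0 and at
  infinity. The comparison succeeds only because a critical point is confined to a range where that
  rate still increases. On the analytic side the equation is known only off the two points and the
  derivatives there are one-sided, so all matching data are read off explicit solutions on open
  intervals.\<close>

lemma exp_ode_general_solution:
  fixes f f1 f2 :: "real \<Rightarrow> complex"
  assumes "convex S" "k \<noteq> 0"
    and f: "\<And>x. x \<in> S \<Longrightarrow> (f has_vector_derivative f1 x) (at x)"
    and f1: "\<And>x. x \<in> S \<Longrightarrow> (f1 has_vector_derivative f2 x) (at x)"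
    and ode: "\<And>x. x \<in> S \<Longrightarrow> f2 x = k\<^sup>2 * f x"
  obtains A B where "\<And>x. x \<in> S \<Longrightarrow> f x = A * exp (k * of_real x) + B * exp (- (k * of_real x))"
proof -
  \<comment> \<open>\<open>D\<^sup>2 - k\<^sup>2 = (D - c) (D + c)\<close> for \<open>c = k\<close> and \<open>c = - k\<close>.\<close>
  have factor: "\<exists>P. \<forall>x\<in>S. f1 x + c * f x = P * exp (c * of_real x)" if c: "c\<^sup>2 = k\<^sup>2" for c
  proof -
    have "((\<lambda>x. (f1 x + c * f x) * exp (- (c * of_real x))) has_vector_derivative 0) (at x within S)"
      if x: "x \<in> S" for x
    proof -
      have e: "((\<lambda>x. exp (- (c * of_real x))) has_vector_derivative - c * exp (- (c * of_real x))) (at x)"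
        by (rule has_vector_derivative_real_field derivative_eq_intros refl | simp)+
      have "((\<lambda>x. (f1 x + c * f x) * exp (- (c * of_real x))) has_vector_derivative
          (f1 x + c * f x) * (- c * exp (- (c * of_real x))) + (f2 x + c * f1 x) * exp (- (c * of_real x))) (at x)"
        by (intro has_vector_derivative_mult e has_vector_derivative_add f1 x
            has_vector_derivative_mult_right f)
      moreover have "(f1 x + c * f x) * (- c * exp (- (c * of_real x)))
          + (f2 x + c * f1 x) * exp (- (c * of_real x)) = 0"
        using c by (simp add: ode[OF x] algebra_simps power2_eq_square)
      ultimately show ?thesis by (simp add: has_vector_derivative_at_within)
    qed
    then obtain P where P: "\<And>x. x \<in> S \<Longrightarrow> (f1 x + c * f x) * exp (- (c * of_real x)) = P"
      using has_vector_derivative_zero_constant[OF \<open>convex S\<close>] by blast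
    then have "\<forall>x\<in>S. f1 x + c * f x = P * exp (c * of_real x)"
      by (auto simp: exp_minus field_simps)
    then show ?thesis ..
  qed
  obtain P Q where P: "\<forall>x\<in>S. f1 x + k * f x = P * exp (k * of_real x)"
    and Q: "\<forall>x\<in>S. f1 x + (- k) * f x = Q * exp ((- k) * of_real x)"
    using factor[of k] factor[of "- k"] by auto
  show ?thesis
  proof (rule that[of "P / (2 * k)" "- Q / (2 * k)"])
    fix x assume x: "x \<in> S"
    have "2 * k * f x = P * exp (k * of_real x) - Q * exp (- (k * of_real x))"
      using P[rule_format, OF x] Q[rule_format, OF x] by (simp add: algebra_simps)
    then show "f x = P / (2 * k) * exp (k * of_real x) + - Q / (2 * k) * exp (- (k * of_real x))"
      using \<open>k \<noteq> 0\<close> by (simp add: field_simps)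
  qed
qed

text \<open>The degenerate case k = 0, where the two exponentials coincide.\<close>

lemma affine_ode_general_solution:
  fixes f f1 :: "real \<Rightarrow> complex"
  assumes "convex S"
    and f: "\<And>x. x \<in> S \<Longrightarrow> (f has_vector_derivative f1 x) (at x)"
    and f1: "\<And>x. x \<in> S \<Longrightarrow> (f1 has_vector_derivative 0) (at x)"
  obtains A B where "\<And>x. x \<in> S \<Longrightarrow> f x = A + B * of_real x"
proof -
  obtain B where B: "\<And>x. x \<in> S \<Longrightarrow> f1 x = B"
    using has_vector_derivative_zero_constant[OF \<open>convex S\<close>] f1 has_vector_derivative_at_within
    by metis
  have "((\<lambda>x. f x - B * of_real x) has_vector_derivative 0) (at x within S)" if x: "x \<in> S" for x
  proof -
    have "((\<lambda>x. f x - B * of_real x) has_vector_derivative f1 x - B * 1) (at x)"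
      by (intro has_vector_derivative_diff f x has_vector_derivative_mult_right
          has_vector_derivative_of_real has_vector_derivative_id) (auto intro!: derivative_eq_intros)
    then show ?thesis using B[OF x] by (simp add: has_vector_derivative_at_within)
  qed
  then obtain A where "\<And>x. x \<in> S \<Longrightarrow> f x - B * of_real x = A"
    using has_vector_derivative_zero_constant[OF \<open>convex S\<close>] by blast
  then show ?thesis by (intro that[of A B]) (simp add: algebra_simps)
qed

section \<open>Square integrability on a half-line\<close>

text \<open>Translates of a square integrable function are square integrable, so the squared modulus
  of the combination is dominated by an integrable function; the lower bound would then make a ray
  have finite measure. Choosing \<open>s\<close> and \<open>c\<close> suitably cancels unwanted
  terms of an explicit solution.\<close>

lemma not_integrable_shift_combination_bounded_below:
  fixes f :: "real \<Rightarrow> complex"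
  assumes int: "integrable lborel (\<lambda>x. (norm (f x))\<^sup>2)" and "C > 0"
    and lower: "\<And>x. x > a \<Longrightarrow> C \<le> norm (f (x + s) - c * f x)"
  shows False
proof -
  have "integrable lborel (\<lambda>x. (norm (f (s + 1 * x)))\<^sup>2)"
    using lborel_integrable_real_affine[OF int, of 1 s] by simp
  then have "integrable lborel (\<lambda>x. 2 * (norm (f (x + s)))\<^sup>2 + 2 * (norm c)\<^sup>2 * (norm (f x))\<^sup>2)"
    using int by (simp add: add.commute)
  then have "integrable lborel (\<lambda>x. indicator {a<..} x *\<^sub>R C\<^sup>2)"
  proof (rule Bochner_Integration.integrable_bound)
    show "AE x in lborel. norm (indicator {a<..} x *\<^sub>R C\<^sup>2)
        \<le> norm (2 * (norm (f (x + s)))\<^sup>2 + 2 * (norm c)\<^sup>2 * (norm (f x))\<^sup>2)"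
    proof (rule AE_I2)
      fix x
      have "C\<^sup>2 \<le> 2 * (norm (f (x + s)))\<^sup>2 + 2 * (norm c)\<^sup>2 * (norm (f x))\<^sup>2" if "x > a"
      proof -
        have "C \<le> norm (f (x + s)) + norm c * norm (f x)"
          using lower[OF that] norm_triangle_ineq4[of "f (x + s)" "c * f x"] by (simp add: norm_mult)
        then have "C\<^sup>2 \<le> (norm (f (x + s)) + norm c * norm (f x))\<^sup>2"
          using \<open>C > 0\<close> by (intro power_mono) auto
        also have "\<dots> \<le> 2 * (norm (f (x + s)))\<^sup>2 + 2 * (norm c * norm (f x))\<^sup>2"
          using sum_squares_bound[of "norm (f (x + s))" "norm c * norm (f x)"]
          by (simp add: power2_sum)
        finally show ?thesis by (simp add: power_mult_distrib)
      qed
      then show "norm (indicator {a<..} x *\<^sub>R C\<^sup>2)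
          \<le> norm (2 * (norm (f (x + s)))\<^sup>2 + 2 * (norm c)\<^sup>2 * (norm (f x))\<^sup>2)"
        by (auto simp: indicator_def)
    qed
  qed auto
  then have "integrable lborel (\<lambda>x. indicat_real {a<..} x)"
    using \<open>C > 0\<close> by (simp add: integrable_mult_left_iff)
  then have "emeasure lborel {a<..} < \<infinity>"
    by (subst (asm) integrable_indicator_iff) auto
  moreover have "emeasure lborel {a<..} \<ge> ennreal n" for n :: nat
  proof -
    have "emeasure lborel {a<..<a + real n} \<le> emeasure lborel {a<..}"
      by (rule emeasure_mono) auto
    then show ?thesis by simp
  qed
  ultimately show False
    by (metis ennreal_of_nat_eq_real_of_nat ennreal_Ex_less_of_nat infinity_ennreal_def leD less_top)
qed

text \<open>Subtracting \<open>exp (- k s) f x\<close> from \<open>f (x + s)\<close> cancels the \<open>B\<close> term; this also covers oscillating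
  solutions, where \<open>k\<close> is imaginary and \<open>\<plusminus> k\<close> are both admissible.\<close>

lemma growing_coefficient_zero:
  fixes f :: "real \<Rightarrow> complex"
  assumes int: "integrable lborel (\<lambda>x. (norm (f x))\<^sup>2)" and k: "k \<noteq> 0" "Re k \<ge> 0"
    and f: "\<And>x. x > a \<Longrightarrow> f x = A * exp (k * of_real x) + B * exp (- (k * of_real x))"
  shows "A = 0"
proof (rule ccontr)
  assume A: "A \<noteq> 0"
  \<comment> \<open>This makes 2 k s have modulus 2, smaller than 2 pi, so it cannot be a nonzero
    multiple of 2 pi i and exp (2 k s) differs from 1.\<close>
  define s where "s = 1 / norm k"
  have s: "s > 0" using k by (simp add: s_def)
  have ne: "exp (k * of_real s) - exp (- (k * of_real s)) \<noteq> 0"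
  proof
    assume "exp (k * of_real s) - exp (- (k * of_real s)) = 0"
    then have "exp (2 * (k * of_real s)) = 1"
      by (simp only: mult_2 exp_add) (simp add: exp_minus field_simps)
    then obtain n :: int where re: "Re (2 * (k * of_real s)) = 0"
      and im: "Im (2 * (k * of_real s)) = of_int (2 * n) * pi"
      using exp_eq_1 by blast
    have "norm (2 * (k * of_real s)) = 2"
      using k by (simp add: s_def norm_mult norm_divide)
    then have "(real_of_int (2 * n) * pi)\<^sup>2 = 2\<^sup>2"
      using cmod_power2[of "2 * (k * of_real s)"] unfolding re im by simp
    then have "\<bar>of_int n * pi\<bar> = 1"
      unfolding power2_eq_iff by (auto simp: mult.commute[of pi])
    then have "\<bar>of_int n\<bar> * pi = 1" by (simp add: abs_mult)
    moreover have "\<bar>real_of_int n\<bar> * pi = 0 \<or> \<bar>of_int n\<bar> * pi \<ge> 1 * pi"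
      by (cases "n = 0") (auto intro!: mult_right_mono)
    ultimately show False using pi_gt3 by auto
  qed
  \<comment> \<open>The modulus of the combination is this expression with x in place of a; it is
    nondecreasing in x because Re k >= 0.\<close>
  define C where "C = norm A * exp (Re k * a) * norm (exp (k * of_real s) - exp (- (k * of_real s)))"
  show False
  proof (rule not_integrable_shift_combination_bounded_below[OF int])
    show "C > 0" using A ne by (simp add: C_def)
    fix x assume x: "x > a"
    have "f (x + s) - exp (- (k * of_real s)) * f x
        = A * exp (k * of_real x) * (exp (k * of_real s) - exp (- (k * of_real s)))"
      using f[of x] f[of "x + s"] x s by (simp add: algebra_simps flip: exp_add)
    then have "norm (f (x + s) - exp (- (k * of_real s)) * f x)
        = norm A * exp (Re k * x) * norm (exp (k * of_real s) - exp (- (k * of_real s)))"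
      by (simp add: norm_mult)
    also have "\<dots> \<ge> C"
      unfolding C_def using x k by (intro mult_right_mono mult_left_mono) (auto intro: mult_left_mono)
    finally show "C \<le> norm (f (x + s) - exp (- (k * of_real s)) * f x)" .
  qed
qed

text \<open>The difference f (x + 1) - f x is the constant B; once B = 0, f itself is the constant
  A.\<close>

lemma affine_coefficients_zero:
  fixes f :: "real \<Rightarrow> complex"
  assumes int: "integrable lborel (\<lambda>x. (norm (f x))\<^sup>2)"
    and f: "\<And>x. x > a \<Longrightarrow> f x = A + B * of_real x"
  shows "A = 0 \<and> B = 0"
proof -
  have B: "B = 0"
  proof (rule ccontr)
    assume "B \<noteq> 0"
    show False
      by (rule not_integrable_shift_combination_bounded_below[OF int, of "norm B" a 1 1])
        (use \<open>B \<noteq> 0\<close> f in \<open>auto simp: algebra_simps\<close>)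
  qed
  have "A = 0"
  proof (rule ccontr)
    assume "A \<noteq> 0"
    show False
      by (rule not_integrable_shift_combination_bounded_below[OF int, of "norm A" a 1 0])
        (use \<open>A \<noteq> 0\<close> f B in auto)
  qed
  with B show ?thesis by simp
qed

section \<open>Matching at the two points and necessity of the secular equation\<close>

text \<open>A one-sided derivative at \<open>a\<close> forces one-sided continuity, so a formula
  valid only on one side of \<open>a\<close> determines both the value and that derivative. This
  turns each explicit solution into boundary data.\<close>

lemma agree_at_boundary:
  fixes f \<phi> :: "real \<Rightarrow> complex"
  assumes f: "(f has_vector_derivative r) (at a within S)"
    and \<phi>: "(\<phi> has_vector_derivative D) (at a within S)"
    and ev: "eventually (\<lambda>x. f x = \<phi> x) (at a within S)" and nt: "at a within S \<noteq> bot"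
  shows "f a = \<phi> a \<and> r = D"
proof -
  have "(f \<longlongrightarrow> f a) (at a within S)" "(\<phi> \<longlongrightarrow> \<phi> a) (at a within S)"
    using f \<phi> has_vector_derivative_continuous continuous_within by blast+
  then have eq: "f a = \<phi> a"
    using nt ev by (metis tendsto_unique tendsto_cong)
  have "eventually (\<lambda>x. x \<in> S \<longrightarrow> f x = \<phi> x) (nhds a)"
    using ev unfolding eventually_at_filter by eventually_elim (use eq in auto)
  then have "(\<phi> has_vector_derivative r) (at a within S)"
    using f has_vector_derivative_cong_ev[of S f \<phi> a] eq by blast
  then show ?thesis using vector_derivative_unique_within[OF nt _ \<phi>] eq by blast
qed

text \<open>One formula serves every sign of l, so both half-lines can be treated before the sign is
  known. For l >= 0 the term \<open>sqrt (- l)\<close> is not a decay rate, but R = 0 makes it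
  irrelevant.\<close>

lemma outer_solution_decays:
  fixes f f1 :: "real \<Rightarrow> complex"
  assumes int: "integrable lborel (\<lambda>x. (norm (f x))\<^sup>2)"
    and f: "\<And>x. x > a \<Longrightarrow> (f has_vector_derivative f1 x) (at x)"
    and f1: "\<And>x. x > a \<Longrightarrow> (f1 has_vector_derivative - (of_real l * f x)) (at x)"
  obtains R where "\<And>x. x > a \<Longrightarrow> f x = R * exp (- (of_real (sqrt (- l)) * of_real x))"
    and "l \<ge> 0 \<Longrightarrow> R = 0"
proof (cases "l = 0")
  case True
  obtain A B where AB: "\<And>x. x \<in> {a<..} \<Longrightarrow> f x = A + B * of_real x"
    using affine_ode_general_solution[of "{a<..}" f f1] f f1 True by auto
  then have "A = 0 \<and> B = 0"
    using affine_coefficients_zero[OF int, of a] by auto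
  with AB show ?thesis by (intro that[of 0]) auto
next
  case False
  define k where "k = (if l < 0 then of_real (sqrt (- l)) else \<i> * of_real (sqrt l))"
  have "k\<^sup>2 = - of_real l"
    using False by (auto simp: k_def power_mult_distrib simp flip: of_real_power)
  have k: "k \<noteq> 0" "Re k \<ge> 0" using False by (auto simp: k_def)
  obtain A B where AB: "\<And>x. x \<in> {a<..} \<Longrightarrow>
      f x = A * exp (k * of_real x) + B * exp (- (k * of_real x))"
    by (rule exp_ode_general_solution[of "{a<..}" k f f1 "\<lambda>x. - (of_real l * f x)"])
      (use f f1 k \<open>k\<^sup>2 = - of_real l\<close> in \<open>simp_all\<close>)
  have A: "A = 0"
    using growing_coefficient_zero[OF int k, of a] AB by auto
  show ?thesis
  proof (cases "l < 0")
    case True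
    then show ?thesis using AB A by (intro that[of B]) (auto simp: k_def)
  next
    case False
    \<comment> \<open>Here k is purely imaginary, so - k also has nonnegative real part and the same
      argument removes the other coefficient.\<close>
    have "B = 0"
      using growing_coefficient_zero[OF int, of "- k" a B A] AB k False
      by (auto simp: k_def add.commute split: if_splits)
    then show ?thesis using AB A by (intro that[of 0]) auto
  qed
qed

lemma exp_combination_has_vector_derivative:
  fixes A B k :: complex
  shows "((\<lambda>x. A * exp (k * of_real x) + B * exp (- (k * of_real x)))
    has_vector_derivative k * A * exp (k * of_real x) - k * B * exp (- (k * of_real x))) (at x within S)"
  by (rule has_vector_derivative_real_field derivative_eq_intros refl | simp)+

text \<open>The data are one-sided limits at an endpoint where the equation need not hold, so they
  are imposed on the explicit solution. Taking a complex square root of - l handles both signs of l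
  together.\<close>

lemma zero_Cauchy_data_imp_zero:
  fixes f f1 :: "real \<Rightarrow> complex"
  assumes f: "\<And>x. a < x \<Longrightarrow> x < b \<Longrightarrow> (f has_vector_derivative f1 x) (at x)"
    and f1: "\<And>x. a < x \<Longrightarrow> x < b \<Longrightarrow> (f1 has_vector_derivative - (of_real l * f x)) (at x)"
    and init: "f a = 0" "(f has_vector_derivative 0) (at_right a)" and x: "a < x" "x < b"
  shows "f x = 0"
proof (cases "l = 0")
  case True
  obtain A B where AB: "\<And>x. x \<in> {a<..<b} \<Longrightarrow> f x = A + B * of_real x"
    using affine_ode_general_solution[of "{a<..<b}" f f1] f f1 True by auto
  have "eventually (\<lambda>x. f x = A + B * of_real x) (at_right a)"
    using x AB by (intro eventually_at_rightI[of a b]) auto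
  moreover have "((\<lambda>x. A + B * of_real x) has_vector_derivative B) (at_right a)"
    by (rule has_vector_derivative_real_field derivative_eq_intros refl | simp)+
  ultimately have "f a = A + B * of_real a \<and> 0 = B"
    using agree_at_boundary[OF init(2)] trivial_limit_at_right_real by blast
  then show ?thesis using AB x init by auto
next
  case False
  define k where "k = csqrt (- of_real l)"
  have k: "k\<^sup>2 = - of_real l" "k \<noteq> 0" using False by (auto simp: k_def)
  obtain A B where AB: "\<And>x. x \<in> {a<..<b} \<Longrightarrow>
      f x = A * exp (k * of_real x) + B * exp (- (k * of_real x))"
    by (rule exp_ode_general_solution[of "{a<..<b}" k f f1 "\<lambda>x. - (of_real l * f x)"])
      (use f f1 k in \<open>simp_all\<close>)
  have "eventually (\<lambda>x. f x = A * exp (k * of_real x) + B * exp (- (k * of_real x))) (at_right a)"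
    using x AB by (intro eventually_at_rightI[of a b]) auto
  then have "f a = A * exp (k * of_real a) + B * exp (- (k * of_real a)) \<and>
      0 = k * A * exp (k * of_real a) - k * B * exp (- (k * of_real a))"
    using agree_at_boundary[OF init(2) exp_combination_has_vector_derivative] trivial_limit_at_right_real
    by blast
  then have sum: "A * exp (k * of_real a) + B * exp (- (k * of_real a)) = 0"
    and diff: "k * (A * exp (k * of_real a) - B * exp (- (k * of_real a))) = 0"
    using init by (auto simp: algebra_simps)
  have "A * exp (k * of_real a) = B * exp (- (k * of_real a))"
    using diff k(2) by simp
  with sum have "2 * (A * exp (k * of_real a)) = 0" "2 * (B * exp (- (k * of_real a))) = 0"
    by (metis mult_2)+
  then have "A = 0 \<and> B = 0" by simp
  then show ?thesis using AB x by auto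
qed

lemma bound_state_imp_secular_equation:
  fixes \<psi> :: "real \<Rightarrow> complex"
  assumes "d > 0" and L2: "square_integrable \<psi>" and nz: "\<psi> x0 \<noteq> 0"
    and ode: "helmholtz_off {- d, d} l \<psi>"
    and dp: "delta_condition d c \<psi>" and dm: "delta_condition (- d) (- c) \<psi>"
  shows "l < 0 \<and> 4 * (sqrt (- l))\<^sup>2 = c\<^sup>2 * (1 - exp (- 4 * sqrt (- l) * d))"
proof -
  define \<kappa> where "\<kappa> = sqrt (- l)"
  define k where "k = complex_of_real \<kappa>"
  define e where "e = exp (k * of_real d)"
  define e' where "e' = exp (- (k * of_real d))"
  have ee: "e * e' = 1" by (simp add: e_def e'_def flip: exp_add)
  obtain \<psi>1 \<psi>2 where "\<And>x. x \<in> - {- d, d} \<Longrightarrow> (\<psi> has_vector_derivative \<psi>1 x) (at x) \<and>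
      (\<psi>1 has_vector_derivative \<psi>2 x) (at x) \<and> - \<psi>2 x = of_real l * \<psi> x"
    using ode unfolding helmholtz_off_def by blast
  then have \<psi>: "\<And>x. x \<noteq> d \<Longrightarrow> x \<noteq> - d \<Longrightarrow> (\<psi> has_vector_derivative \<psi>1 x) (at x)"
    and \<psi>1: "\<And>x. x \<noteq> d \<Longrightarrow> x \<noteq> - d \<Longrightarrow> (\<psi>1 has_vector_derivative - (of_real l * \<psi> x)) (at x)"
    by (auto simp: minus_equation_iff[of "\<psi>2 _"])
  have int: "integrable lborel (\<lambda>x. (norm (\<psi> x))\<^sup>2)"
    using L2 by (simp add: square_integrable_def)
  then have int': "integrable lborel (\<lambda>x. (norm (\<psi> (- x)))\<^sup>2)"
    using lborel_integrable_real_affine[OF int, of "-1" 0] by simp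
  have refl: "((\<lambda>x. f (- x)) has_vector_derivative - D) (at x)"
    if "(f has_vector_derivative D) (at (- x))" for f :: "real \<Rightarrow> complex" and D x
  proof -
    have "((\<lambda>x::real. - x) has_vector_derivative -1) (at x)"
      by (auto intro!: derivative_eq_intros)
    from vector_diff_chain_at[OF this that] show ?thesis by (simp add: o_def)
  qed
  obtain R where R: "\<And>x. x > d \<Longrightarrow> \<psi> x = R * exp (- (k * of_real x))" "l \<ge> 0 \<Longrightarrow> R = 0"
  proof (rule outer_solution_decays[OF int, of d \<psi>1 l])
    fix x assume "x > d"
    then show "(\<psi> has_vector_derivative \<psi>1 x) (at x)"
      "(\<psi>1 has_vector_derivative - (of_real l * \<psi> x)) (at x)"
      using \<open>d > 0\<close> by (auto intro!: \<psi> \<psi>1)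
  qed (use that in \<open>auto simp: k_def \<kappa>_def\<close>)
  \<comment> \<open>The left half-line is the right one for the reflected function, which solves the
    same equation.\<close>
  obtain L where L: "\<And>x. x > d \<Longrightarrow> \<psi> (- x) = L * exp (- (k * of_real x))" "l \<ge> 0 \<Longrightarrow> L = 0"
  proof (rule outer_solution_decays[OF int', of d "\<lambda>x. - \<psi>1 (- x)" l])
    fix x assume "x > d"
    then show "((\<lambda>x. \<psi> (- x)) has_vector_derivative - \<psi>1 (- x)) (at x)"
      using \<open>d > 0\<close> by (intro refl \<psi>) auto
    show "((\<lambda>x. - \<psi>1 (- x)) has_vector_derivative - (of_real l * \<psi> (- x))) (at x)"
      using refl[OF \<psi>1[of "- x"]] \<open>d > 0\<close> \<open>x > d\<close> by (auto dest!: has_vector_derivative_minus)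
  qed (use that in \<open>auto simp: k_def \<kappa>_def\<close>)
  have L': "\<psi> x = L * exp (k * of_real x)" if "x < - d" for x
    using L(1)[of "- x"] that by simp
  obtain r l' where r: "(\<psi> has_vector_derivative r) (at_right d)" "(\<psi> has_vector_derivative l') (at_left d)"
    "- r + l' + of_real c * \<psi> d = 0"
    using dp unfolding delta_condition_def by blast
  obtain s m where s: "(\<psi> has_vector_derivative s) (at_right (- d))"
    "(\<psi> has_vector_derivative m) (at_left (- d))" "- s + m - of_real c * \<psi> (- d) = 0"
    using dm unfolding delta_condition_def by auto
  have "eventually (\<lambda>x. \<psi> x = 0 * exp (k * of_real x) + R * exp (- (k * of_real x))) (at_right d)"
    using R by (intro eventually_at_rightI[of d "d + 1"]) auto
  from agree_at_boundary[OF r(1) exp_combination_has_vector_derivative this]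
  have bR: "\<psi> d = R * e'" "r = - (k * R * e')" by (auto simp: e'_def)
  have "eventually (\<lambda>x. \<psi> x = L * exp (k * of_real x) + 0 * exp (- (k * of_real x))) (at_left (- d))"
    using L' by (intro eventually_at_leftI[of "- d - 1" "- d"]) auto
  from agree_at_boundary[OF s(2) exp_combination_has_vector_derivative this]
  have bL: "\<psi> (- d) = L * e'" "m = k * L * e'" by (auto simp: e'_def)
  have "l < 0"
  proof (rule ccontr)
    assume "\<not> l < 0"
    then have RL: "R = 0" "L = 0" using R(2) L(2) by auto
    \<comment> \<open>With L = 0 both \<open>\<psi> (- d)\<close> and the left derivative
      \<open>m\<close> vanish, so the jump condition gives \<open>s = 0\<close>.\<close>
    then have "\<psi> x = 0" if "- d < x" "x < d" for x
      using zero_Cauchy_data_imp_zero[of "- d" d \<psi> \<psi>1 l x] \<psi> \<psi>1 that s bL by force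
    moreover have "\<psi> x = 0" if "x < - d \<or> x = - d \<or> x = d \<or> d < x" for x
      using that R(1) L' RL bR bL by auto
    ultimately show False using nz by (metis linorder_less_linear)
  qed
  then have \<kappa>: "\<kappa> > 0" "k \<noteq> 0" "k\<^sup>2 = - of_real l"
    by (auto simp: k_def \<kappa>_def simp flip: of_real_power)
  obtain A B where AB: "\<And>x. x \<in> {- d<..<d} \<Longrightarrow>
      \<psi> x = A * exp (k * of_real x) + B * exp (- (k * of_real x))"
    by (rule exp_ode_general_solution[of "{- d<..<d}" k \<psi> \<psi>1 "\<lambda>x. - (of_real l * \<psi> x)"])
      (use \<psi> \<psi>1 \<kappa> in \<open>simp_all\<close>)
  have "eventually (\<lambda>x. \<psi> x = A * exp (k * of_real x) + B * exp (- (k * of_real x))) (at_left d)"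
    using AB \<open>d > 0\<close> by (intro eventually_at_leftI[of "- d" d]) auto
  from agree_at_boundary[OF r(2) exp_combination_has_vector_derivative this]
  have bd: "\<psi> d = A * e + B * e'" "l' = k * A * e - k * B * e'" by (auto simp: e_def e'_def)
  have "eventually (\<lambda>x. \<psi> x = A * exp (k * of_real x) + B * exp (- (k * of_real x))) (at_right (- d))"
    using AB \<open>d > 0\<close> by (intro eventually_at_rightI[of "- d" d]) auto
  from agree_at_boundary[OF s(1) exp_combination_has_vector_derivative this]
  have bmd: "\<psi> (- d) = A * e' + B * e" "s = k * A * e' - k * B * e" by (auto simp: e_def e'_def)
  have AB0: "A \<noteq> 0 \<or> B \<noteq> 0"
  proof (rule ccontr)
    assume "\<not> ?thesis"
    then have "R = 0" "L = 0" using bd(1) bmd(1) bR(1) bL(1) by (auto simp: e'_def)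
    moreover from \<open>\<not> ?thesis\<close> have "\<psi> x = 0" if "- d < x" "x < d" for x
      using AB that by auto
    moreover from calculation have "\<psi> x = 0" if "x < - d \<or> x = - d \<or> x = d \<or> d < x" for x
      using that R(1) L' bR bL by auto
    ultimately show False using nz by (metis linorder_less_linear)
  qed
  define C where "C = complex_of_real c"
  \<comment> \<open>Outside, the derivative at the boundary is - k or k times the value, so R and L
    drop out and each jump condition is a linear relation between A and B.\<close>
  have 1: "(2 * k + C) * e * A = - C * e' * B"
    using r(3) bd bR by (simp add: C_def) algebra
  have 2: "(2 * k - C) * e * B = C * e' * A"
    using s(3) bmd bL by (simp add: C_def) algebra
  \<comment> \<open>The determinant of the system for A and B annihilates each unknown; dividing by
    e^2, using e e' = 1, gives the secular equation.\<close>
  have "((4 * k\<^sup>2 - C\<^sup>2) * e\<^sup>2 + C\<^sup>2 * e'\<^sup>2) * A = 0" "((4 * k\<^sup>2 - C\<^sup>2) * e\<^sup>2 + C\<^sup>2 * e'\<^sup>2) * B = 0"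
    using 1 2 by algebra+
  then have "(4 * k\<^sup>2 - C\<^sup>2) * e\<^sup>2 + C\<^sup>2 * e'\<^sup>2 = 0" using AB0 by auto
  then have "4 * k\<^sup>2 = C\<^sup>2 * (1 - e' ^ 4)" using ee by algebra
  moreover have "e' ^ 4 = of_real (exp (- 4 * \<kappa> * d))"
    by (simp add: e'_def k_def mult_ac flip: exp_of_nat_mult exp_of_real)
  ultimately have "complex_of_real (4 * \<kappa>\<^sup>2) = of_real (c\<^sup>2 * (1 - exp (- 4 * \<kappa> * d)))"
    by (simp add: k_def C_def)
  then show ?thesis using \<open>l < 0\<close> unfolding of_real_eq_iff \<kappa>_def by simp
qed

section \<open>Construction of a bound state\<close>

lemma integrable_exp_minus_abs:
  assumes "m > 0"
  shows "integrable lborel (\<lambda>x::real. exp (- m * \<bar>x\<bar>))"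
proof -
  have half: "integrable lborel (\<lambda>x::real. indicator {0..} x * exp (- m * x))"
  proof (rule integrableI_nonneg)
    have "(\<integral>\<^sup>+x. ennreal (exp (- m * x)) * indicator {0..} x \<partial>lborel) = ennreal (0 - (- exp (- m * 0) / m))"
    proof (rule nn_integral_FTC_atLeast)
      show "((\<lambda>x. - exp (- m * x) / m) \<longlongrightarrow> 0) at_top"
        using assms by real_asymp
      show "((\<lambda>x. - exp (- m * x) / m) has_real_derivative exp (- m * x)) (at x)" for x
        using assms by (auto intro!: derivative_eq_intros)
    qed auto
    moreover have "ennreal (indicator {0..} x * exp (- m * x)) = ennreal (exp (- m * x)) * indicator {0..} x" for x :: real
      by (auto simp: indicator_def)
    ultimately show "(\<integral>\<^sup>+x. ennreal (indicator {0..} x * exp (- m * x)) \<partial>lborel) < \<infinity>"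
      by simp
  qed auto
  \<comment> \<open>The point 0 is counted twice, which only enlarges the dominating
    function.\<close>
  have "integrable lborel (\<lambda>x::real. indicator {0..} x * exp (- m * x) +
      indicator {0..} (0 + (-1) * x) * exp (- m * (0 + (-1) * x)))"
    by (intro Bochner_Integration.integrable_add half lborel_integrable_real_affine[OF half]) auto
  then show ?thesis
    by (rule Bochner_Integration.integrable_bound) (auto simp: indicator_def intro!: AE_I2)
qed

text \<open>The sign of x - p is constant on the half-line \<open>S\<close> containing x, so |x - p|
  is linear there; its square is 1, which yields the factor \<kappa>^2.\<close>

lemma exp_abs_has_derivative:
  fixes \<kappa> p x :: real
  assumes "x \<noteq> p"
  shows "((\<lambda>x. exp (- \<kappa> * \<bar>x - p\<bar>)) has_real_derivative - \<kappa> * sgn (x - p) * exp (- \<kappa> * \<bar>x - p\<bar>)) (at x)"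
    and "((\<lambda>x. - \<kappa> * sgn (x - p) * exp (- \<kappa> * \<bar>x - p\<bar>)) has_real_derivative
      \<kappa>\<^sup>2 * exp (- \<kappa> * \<bar>x - p\<bar>)) (at x)"
proof -
  define S where "S = (if x < p then {..<p} else {p<..})"
  have S: "x \<in> S" "open S" and sgn: "\<And>y. y \<in> S \<Longrightarrow> sgn (y - p) = sgn (x - p)"
    using assms by (auto simp: S_def sgn_if split: if_splits)
  have eq: "\<bar>y - p\<bar> = sgn (x - p) * (y - p)" if "y \<in> S" for y
    using sgn[OF that] by (metis abs_sgn mult.commute)
  show *: "((\<lambda>x. exp (- \<kappa> * \<bar>x - p\<bar>)) has_real_derivative - \<kappa> * sgn (x - p) * exp (- \<kappa> * \<bar>x - p\<bar>)) (at x)"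
  proof (rule has_field_derivative_transform_within_open[OF _ S(2,1)])
    show "((\<lambda>y. exp (- \<kappa> * (sgn (x - p) * (y - p)))) has_real_derivative
        - \<kappa> * sgn (x - p) * exp (- \<kappa> * \<bar>x - p\<bar>)) (at x)"
      using eq[OF S(1)] by (auto intro!: derivative_eq_intros)
  qed (simp add: eq)
  have "sgn (x - p) * sgn (x - p) = 1" using assms by (simp add: sgn_if)
  then have "- \<kappa> * sgn (x - p) * (- \<kappa> * sgn (x - p) * exp (- \<kappa> * \<bar>x - p\<bar>)) = \<kappa>\<^sup>2 * exp (- \<kappa> * \<bar>x - p\<bar>)"
    by (simp add: power2_eq_square algebra_simps) 
  then have "((\<lambda>y. - \<kappa> * sgn (x - p) * exp (- \<kappa> * \<bar>y - p\<bar>)) has_real_derivative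
      \<kappa>\<^sup>2 * exp (- \<kappa> * \<bar>x - p\<bar>)) (at x)"
    using DERIV_cmult[OF *, of "- \<kappa> * sgn (x - p)"] by (simp only:)
  then show "((\<lambda>x. - \<kappa> * sgn (x - p) * exp (- \<kappa> * \<bar>x - p\<bar>)) has_real_derivative
      \<kappa>\<^sup>2 * exp (- \<kappa> * \<bar>x - p\<bar>)) (at x)"
    by (rule has_field_derivative_transform_within_open[OF _ S(2,1)]) (simp add: sgn)
qed

text \<open>The slope drops by 2 \<kappa> at the kink, which is what balances the delta
  interaction.\<close>

lemma exp_abs_has_one_sided_derivatives:
  fixes \<kappa> p :: real
  shows "((\<lambda>x. exp (- \<kappa> * \<bar>x - p\<bar>)) has_real_derivative - \<kappa>) (at_right p)"
    and "((\<lambda>x. exp (- \<kappa> * \<bar>x - p\<bar>)) has_real_derivative \<kappa>) (at_left p)"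
proof -
  have "((\<lambda>x. exp (- \<kappa> * (x - p))) has_real_derivative - \<kappa>) (at_right p)"
    by (auto intro!: derivative_eq_intros)
  then show "((\<lambda>x. exp (- \<kappa> * \<bar>x - p\<bar>)) has_real_derivative - \<kappa>) (at_right p)"
    by (subst has_field_derivative_cong_eventually) (auto simp: eventually_at_filter)
  have "((\<lambda>x. exp (- \<kappa> * (p - x))) has_real_derivative \<kappa>) (at_left p)"
    by (auto intro!: derivative_eq_intros)
  then show "((\<lambda>x. exp (- \<kappa> * \<bar>x - p\<bar>)) has_real_derivative \<kappa>) (at_left p)"
    by (subst has_field_derivative_cong_eventually) (auto simp: eventually_at_filter)
qed

lemma secular_equation_imp_bound_state:
  fixes l c d :: real
  defines "\<kappa> \<equiv> sqrt (- l)"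
  assumes "d > 0" "l < 0" and sec: "4 * \<kappa>\<^sup>2 = c\<^sup>2 * (1 - exp (- 4 * \<kappa> * d))"
  obtains \<psi> where "square_integrable \<psi>" "\<psi> d \<noteq> 0" "continuous_on UNIV \<psi>"
    "helmholtz_off {- d, d} l \<psi>" "delta_condition d c \<psi>" "delta_condition (- d) (- c) \<psi>"
proof -
  define E where "E = exp (- \<kappa> * (2 * d))"
  \<comment> \<open>The condition at d reads (2 \<kappa> + c) a + c E b = 0, where E is the value of
    either exponential at the centre of the other. This pair solves it identically; the condition at
    - d then becomes the secular equation.\<close>
  define a where "a = c * E"
  define b where "b = - (2 * \<kappa> + c)"
  define h where "h = (\<lambda>p x. exp (- \<kappa> * \<bar>x - p\<bar>))"
  define h1 where "h1 = (\<lambda>p x. - \<kappa> * sgn (x - p) * exp (- \<kappa> * \<bar>x - p\<bar>))"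
  define u where "u = (\<lambda>x. a * h d x + b * h (- d) x)"
  define \<psi> where "\<psi> = (\<lambda>x. complex_of_real (u x))"
  have \<kappa>: "\<kappa> > 0" "\<kappa>\<^sup>2 = - l" using \<open>l < 0\<close> by (auto simp: \<kappa>_def)
  have E2: "E\<^sup>2 = exp (- 4 * \<kappa> * d)"
    by (simp add: E_def flip: exp_of_nat_mult)
  have ud: "u d = a + b * E" and umd: "u (- d) = a * E + b"
    using \<open>d > 0\<close> by (auto simp: u_def h_def E_def mult_ac)
  have cont: "continuous_on UNIV \<psi>"
    by (auto simp: \<psi>_def u_def h_def intro!: continuous_intros)
  have L2: "square_integrable \<psi>"
    unfolding square_integrable_def
  proof
    show meas: "\<psi> \<in> borel_measurable lborel"
      using borel_measurable_continuous_onI[OF cont] by simp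
    have I: "integrable lborel (\<lambda>x. (h p x)\<^sup>2)" for p
    proof -
      have "integrable lborel (\<lambda>x. exp (- (2 * \<kappa>) * \<bar>- p + 1 * x\<bar>))"
        using \<kappa> by (intro lborel_integrable_real_affine integrable_exp_minus_abs) auto
      moreover have "(h p x)\<^sup>2 = exp (- (2 * \<kappa>) * \<bar>- p + 1 * x\<bar>)" for x
        by (simp add: h_def algebra_simps flip: exp_of_nat_mult)
      ultimately show ?thesis by simp
    qed
    have "integrable lborel (\<lambda>x. 2 * a\<^sup>2 * (h d x)\<^sup>2 + 2 * b\<^sup>2 * (h (- d) x)\<^sup>2)"
      by (intro Bochner_Integration.integrable_add integrable_mult_right I)
    then show "integrable lborel (\<lambda>x. (norm (\<psi> x))\<^sup>2)"
    proof (rule Bochner_Integration.integrable_bound)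
      show "(\<lambda>x. (norm (\<psi> x))\<^sup>2) \<in> borel_measurable lborel" using meas by measurable
      have "(u x)\<^sup>2 \<le> 2 * a\<^sup>2 * (h d x)\<^sup>2 + 2 * b\<^sup>2 * (h (- d) x)\<^sup>2" for x
        using sum_squares_bound[of "a * h d x" "b * h (- d) x"]
        by (simp add: u_def power2_sum power_mult_distrib)
      then show "AE x in lborel. norm ((norm (\<psi> x))\<^sup>2)
          \<le> norm (2 * a\<^sup>2 * (h d x)\<^sup>2 + 2 * b\<^sup>2 * (h (- d) x)\<^sup>2)"
        by (intro AE_I2) (simp add: \<psi>_def)
    qed
  qed
  have h: "(h p has_real_derivative h1 p x) (at x)"
    "(h1 p has_real_derivative \<kappa>\<^sup>2 * h p x) (at x)" if "x \<noteq> p" for p x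
    using exp_abs_has_derivative[OF that] unfolding h_def h1_def by auto
  have hr: "(h p has_real_derivative - \<kappa>) (at_right p)" "(h p has_real_derivative \<kappa>) (at_left p)" for p
    using exp_abs_has_one_sided_derivatives[of \<kappa> p] unfolding h_def by auto
  have lift: "((\<lambda>x. complex_of_real (a * v x + b * w x)) has_vector_derivative
      of_real (a * v' + b * w')) (at x within S)"
    if "(v has_real_derivative v') (at x within S)" "(w has_real_derivative w') (at x within S)"
    for v w v' w' x S
    using that by (intro has_vector_derivative_of_real) (auto simp flip: has_real_derivative_iff_has_vector_derivative intro!: derivative_eq_intros)
  have ode: "helmholtz_off {- d, d} l \<psi>"
    unfolding helmholtz_off_def
  proof (intro exI ballI conjI)
    fix x assume "x \<in> - {- d, d}"
    then have x: "x \<noteq> d" "x \<noteq> - d" by auto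
    show "(\<psi> has_vector_derivative of_real (a * h1 d x + b * h1 (- d) x)) (at x)"
      unfolding \<psi>_def u_def by (intro lift h x)
    show "((\<lambda>x. complex_of_real (a * h1 d x + b * h1 (- d) x)) has_vector_derivative
        of_real (a * (\<kappa>\<^sup>2 * h d x) + b * (\<kappa>\<^sup>2 * h (- d) x))) (at x)"
      by (intro lift h x)
    show "- complex_of_real (a * (\<kappa>\<^sup>2 * h d x) + b * (\<kappa>\<^sup>2 * h (- d) x)) = of_real l * \<psi> x"
      by (simp add: \<psi>_def u_def \<kappa>(2) algebra_simps)
  qed
  have h1d: "h1 (- d) d = - \<kappa> * E" "h1 d (- d) = \<kappa> * E"
    using \<open>d > 0\<close> by (auto simp: h1_def E_def sgn_if mult_ac)
  have hd: "(h (- d) has_real_derivative - \<kappa> * E) (at d within S)"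
    "(h d has_real_derivative \<kappa> * E) (at (- d) within S)" for S
    using h(1)[of d "- d"] h(1)[of "- d" d] \<open>d > 0\<close> h1d by (auto intro: has_field_derivative_at_within)
  have dp: "delta_condition d c \<psi>"
    unfolding delta_condition_def
  proof (intro exI conjI)
    show "(\<psi> has_vector_derivative of_real (a * - \<kappa> + b * (- \<kappa> * E))) (at_right d)"
      "(\<psi> has_vector_derivative of_real (a * \<kappa> + b * (- \<kappa> * E))) (at_left d)"
      unfolding \<psi>_def u_def by (intro lift hr hd)+
    have "2 * \<kappa> * a + c * (a + b * E) = 0" by (simp add: a_def b_def algebra_simps)
    then have "- (a * - \<kappa> + b * (- \<kappa> * E)) + (a * \<kappa> + b * (- \<kappa> * E)) + c * u d = 0"
      by (simp add: ud algebra_simps)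
    then show "- complex_of_real (a * - \<kappa> + b * (- \<kappa> * E)) + of_real (a * \<kappa> + b * (- \<kappa> * E))
        + of_real c * \<psi> d = 0"
      unfolding \<psi>_def by (metis of_real_0 of_real_add of_real_minus of_real_mult)
  qed
  have dm: "delta_condition (- d) (- c) \<psi>"
    unfolding delta_condition_def
  proof (intro exI conjI)
    show "(\<psi> has_vector_derivative of_real (a * (\<kappa> * E) + b * - \<kappa>)) (at_right (- d))"
      "(\<psi> has_vector_derivative of_real (a * (\<kappa> * E) + b * \<kappa>)) (at_left (- d))"
      unfolding \<psi>_def u_def by (intro lift hr hd)+
    have "2 * \<kappa> * b - c * (a * E + b) = c\<^sup>2 * (1 - E\<^sup>2) - 4 * \<kappa>\<^sup>2"
      by (simp add: a_def b_def algebra_simps power2_eq_square)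
    then have "2 * \<kappa> * b - c * (a * E + b) = 0" using sec E2 by simp
    then have "- (a * (\<kappa> * E) + b * - \<kappa>) + (a * (\<kappa> * E) + b * \<kappa>) + - c * u (- d) = 0"
      by (simp add: umd algebra_simps)
    then show "- complex_of_real (a * (\<kappa> * E) + b * - \<kappa>) + of_real (a * (\<kappa> * E) + b * \<kappa>)
        + of_real (- c) * \<psi> (- d) = 0"
      unfolding \<psi>_def by (metis of_real_0 of_real_add of_real_minus of_real_mult)
  qed
  have "u d = - 2 * \<kappa> * E" by (simp add: ud a_def b_def algebra_simps)
  then have "\<psi> d \<noteq> 0" using \<kappa> by (simp add: \<psi>_def E_def)
  with that[of \<psi>] L2 cont ode dp dm show ?thesis by blast
qed

section \<open>Counting the eigenvalues\<close>

text \<open>For \<open>\<omega>\<close> in \<open>G\<^sub>-\<close> or \<open>G\<^sub>+\<close>, \<open>\<kappa>\<^sup>2 = - \<lambda>(\<omega>)\<close> is a quadratic equation for \<open>\<bar>\<omega> - \<Omega>\<bar>\<close>;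
  below, \<open>N = g\<^sup>2 \<rho>\<^sub>0\<close> and \<open>dist_minus\<close>, \<open>dist_plus\<close> are the respective positive roots.\<close>

definition root_disc :: "real \<Rightarrow> real \<Rightarrow> real \<Rightarrow> real" where
  "root_disc \<Omega> N k = sqrt ((\<Omega> + k\<^sup>2)\<^sup>2 + 4 * N)"

definition dist_minus :: "real \<Rightarrow> real \<Rightarrow> real \<Rightarrow> real" where
  "dist_minus \<Omega> N k = (root_disc \<Omega> N k + (\<Omega> + k\<^sup>2)) / 2"

definition dist_plus :: "real \<Rightarrow> real \<Rightarrow> real \<Rightarrow> real" where
  "dist_plus \<Omega> N k = (root_disc \<Omega> N k - (\<Omega> + k\<^sup>2)) / 2"

text \<open>The factor of the required coupling that depends on \<kappa> alone, without the constant
  2 / g^2.\<close>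

definition coupling_weight :: "real \<Rightarrow> real \<Rightarrow> real" where
  "coupling_weight d k = k / sqrt (1 - exp (- 4 * k * d))"

section \<open>The decay rate as a coordinate on the two bands\<close>

text \<open>Over the denominator \<omega> - \<Omega> the numerator is a quadratic with roots
  \<open>m\<close> and \<open>p\<close>, and m < 0 < \<Omega> < p; the rest is a sign table.\<close>

lemma lam_neg_iff:
  assumes "g > 0" "\<Omega> > 0" "\<rho> > 0" "\<omega> \<noteq> \<Omega>"
  shows "lam g \<Omega> \<rho> \<omega> < 0 \<longleftrightarrow> \<omega> \<in> G_minus g \<Omega> \<rho> \<union> G_plus g \<Omega> \<rho>"
proof -
  define r where "r = sqrt (\<Omega>\<^sup>2 + 4 * g\<^sup>2 * \<rho>)"
  have N: "g\<^sup>2 * \<rho> > 0" using assms by simp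
  have r2: "r\<^sup>2 = \<Omega>\<^sup>2 + 4 * g\<^sup>2 * \<rho>" using assms by (simp add: r_def)
  have r: "r > \<Omega>" unfolding r_def using assms N by (intro real_less_rsqrt) auto
  define p where "p = (\<Omega> + r) / 2"
  define m where "m = (\<Omega> - r) / 2"
  have "(\<omega> - p) * (\<omega> - m) = \<omega> * (\<omega> - \<Omega>) - g\<^sup>2 * \<rho>"
    using r2 by (simp add: p_def m_def field_simps power2_eq_square)
  then have "lam g \<Omega> \<rho> \<omega> = (\<omega> - p) * (\<omega> - m) / (\<omega> - \<Omega>)"
    using assms by (simp add: lam_def diff_divide_distrib)
  moreover have "m < 0" "\<Omega> < p" using r by (auto simp: p_def m_def)
  ultimately have "lam g \<Omega> \<rho> \<omega> < 0 \<longleftrightarrow> \<omega> < m \<or> \<Omega> < \<omega> \<and> \<omega> < p"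
    using \<open>\<Omega> > 0\<close> \<open>\<omega> \<noteq> \<Omega>\<close> by (auto simp: divide_less_0_iff mult_less_0_iff zero_less_mult_iff)
  then show ?thesis
    by (simp add: G_minus_def G_plus_def omega_minus_def omega_plus_def p_def m_def r_def)
qed

lemma G_minus_less:
  assumes "g > 0" "\<Omega> > 0" "\<rho> > 0" "\<omega> \<in> G_minus g \<Omega> \<rho>"
  shows "\<omega> < \<Omega>"
proof -
  have "sqrt (\<Omega>\<^sup>2 + 4 * g\<^sup>2 * \<rho>) \<ge> 0" using assms by simp
  moreover have "\<omega> < (\<Omega> - sqrt (\<Omega>\<^sup>2 + 4 * g\<^sup>2 * \<rho>)) / 2"
    using assms by (simp add: G_minus_def omega_minus_def)
  ultimately show ?thesis using \<open>\<Omega> > 0\<close> by argo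
qed

lemma kappa_pos:
  assumes "g > 0" "\<Omega> > 0" "\<rho> > 0" "\<omega> \<noteq> \<Omega>" "\<omega> \<in> G_minus g \<Omega> \<rho> \<union> G_plus g \<Omega> \<rho>"
  shows "kappa g \<Omega> \<rho> \<omega> > 0" "(kappa g \<Omega> \<rho> \<omega>)\<^sup>2 = - lam g \<Omega> \<rho> \<omega>"
  using lam_neg_iff[of g \<Omega> \<rho> \<omega>] assms by (auto simp: kappa_def)

text \<open>Complete the square in t (t - (\<Omega> + K)) = N, where N = g^2 \<rho>. The sign of the
  root is settled by 2 t - (\<Omega> + K) = t + N / t > 0.\<close>

lemma dist_minus_kappa:
  assumes "g > 0" "\<Omega> > 0" "\<rho> > 0" "\<omega> \<in> G_minus g \<Omega> \<rho>"
  shows "\<Omega> - \<omega> = dist_minus \<Omega> (g\<^sup>2 * \<rho>) (kappa g \<Omega> \<rho> \<omega>)"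
proof -
  define t where "t = \<Omega> - \<omega>"
  have t: "t > 0" using G_minus_less[OF assms] by (simp add: t_def)
  define K where "K = (kappa g \<Omega> \<rho> \<omega>)\<^sup>2"
  have "K = - lam g \<Omega> \<rho> \<omega>" using kappa_pos[of g \<Omega> \<rho> \<omega>] assms t by (auto simp: K_def t_def)
  also have "\<omega> = \<Omega> - t" by (simp add: t_def)
  also have "- lam g \<Omega> \<rho> (\<Omega> - t) = t - \<Omega> - g\<^sup>2 * \<rho> / t" by (simp add: lam_def)
  finally have K: "t - (\<Omega> + K) = g\<^sup>2 * \<rho> / t" by simp
  then have "t * (t - (\<Omega> + K)) = g\<^sup>2 * \<rho>" using t by simp
  then have "(2 * t - (\<Omega> + K))\<^sup>2 = (\<Omega> + K)\<^sup>2 + 4 * (g\<^sup>2 * \<rho>)" by algebra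
  moreover have "g\<^sup>2 * \<rho> / t > 0" using assms t by simp
  ultimately have "sqrt ((\<Omega> + K)\<^sup>2 + 4 * (g\<^sup>2 * \<rho>)) = 2 * t - (\<Omega> + K)"
    using K t by (intro real_sqrt_unique) (assumption, argo)
  then show ?thesis by (simp add: dist_minus_def root_disc_def flip: t_def K_def)
qed

lemma dist_plus_kappa:
  assumes "g > 0" "\<Omega> > 0" "\<rho> > 0" "\<omega> \<in> G_plus g \<Omega> \<rho>"
  shows "\<omega> - \<Omega> = dist_plus \<Omega> (g\<^sup>2 * \<rho>) (kappa g \<Omega> \<rho> \<omega>)"
proof -
  define s where "s = \<omega> - \<Omega>"
  have s: "s > 0" using assms by (simp add: s_def G_plus_def)
  define K where "K = (kappa g \<Omega> \<rho> \<omega>)\<^sup>2"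
  have "K = - lam g \<Omega> \<rho> \<omega>" using kappa_pos[of g \<Omega> \<rho> \<omega>] assms s by (auto simp: K_def s_def)
  also have "\<dots> = g\<^sup>2 * \<rho> / s - s - \<Omega>"
    by (simp add: lam_def s_def)
  finally have K: "s + (\<Omega> + K) = g\<^sup>2 * \<rho> / s" by simp
  then have "s * (s + (\<Omega> + K)) = g\<^sup>2 * \<rho>" using s by simp
  then have "(2 * s + (\<Omega> + K))\<^sup>2 = (\<Omega> + K)\<^sup>2 + 4 * (g\<^sup>2 * \<rho>)" by algebra
  moreover have "K \<ge> 0" by (simp add: K_def)
  ultimately have "sqrt ((\<Omega> + K)\<^sup>2 + 4 * (g\<^sup>2 * \<rho>)) = 2 * s + (\<Omega> + K)"
    using s assms by (intro real_sqrt_unique) auto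
  then show ?thesis by (simp add: dist_plus_def root_disc_def flip: s_def K_def)
qed

lemma root_disc_gt:
  assumes "\<Omega> > 0" "N > 0"
  shows "root_disc \<Omega> N k > \<Omega> + k\<^sup>2"
  unfolding root_disc_def using assms by (intro real_less_rsqrt) auto

lemma root_disc_power2: "N > 0 \<Longrightarrow> (root_disc \<Omega> N k)\<^sup>2 = (\<Omega> + k\<^sup>2)\<^sup>2 + 4 * N"
  by (simp add: root_disc_def)

text \<open>Every k > 0 is attained on G_-, which existence needs. On G_+ only an upper bound is
  claimed, so recovering \<omega> from \<kappa> suffices there.\<close>

lemma dist_minus_in_G_minus:
  assumes "g > 0" "\<Omega> > 0" "\<rho> > 0" "k > 0"
  defines "t \<equiv> dist_minus \<Omega> (g\<^sup>2 * \<rho>) k"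
  shows "t > 0" "\<Omega> - t \<in> G_minus g \<Omega> \<rho>" "kappa g \<Omega> \<rho> (\<Omega> - t) = k"
proof -
  have N: "g\<^sup>2 * \<rho> > 0" using assms by simp
  show t: "t > 0"
    using root_disc_gt[OF \<open>\<Omega> > 0\<close> N, of k] assms(2) zero_le_power2[of k]
    unfolding t_def dist_minus_def by argo
  have "t * (t - (\<Omega> + k\<^sup>2)) = g\<^sup>2 * \<rho>"
    using root_disc_power2[OF N, of \<Omega> k] by (simp add: t_def dist_minus_def field_simps power2_eq_square)
  then have "t - (\<Omega> + k\<^sup>2) = g\<^sup>2 * \<rho> / t" using t by (simp add: field_simps)
  then have lam: "lam g \<Omega> \<rho> (\<Omega> - t) = - k\<^sup>2" by (simp add: lam_def)
  then show "kappa g \<Omega> \<rho> (\<Omega> - t) = k" using assms by (simp add: kappa_def)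
  have "\<Omega> - t \<in> G_minus g \<Omega> \<rho> \<union> G_plus g \<Omega> \<rho>"
    using lam_neg_iff[of g \<Omega> \<rho> "\<Omega> - t"] assms(1-4) t lam by simp
  then show "\<Omega> - t \<in> G_minus g \<Omega> \<rho>" using t by (auto simp: G_plus_def)
qed

lemma dist_minus_strict_mono:
  assumes "\<Omega> > 0" "N > 0" "0 < x" "x < y"
  shows "dist_minus \<Omega> N x < dist_minus \<Omega> N y"
proof -
  have "x\<^sup>2 < y\<^sup>2" using assms by (intro power_strict_mono) auto
  moreover from this have "(\<Omega> + x\<^sup>2)\<^sup>2 < (\<Omega> + y\<^sup>2)\<^sup>2"
    using assms by (intro power_strict_mono) auto
  ultimately show ?thesis by (simp add: dist_minus_def root_disc_def add_strict_mono)
qed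

section \<open>Monotonicity and log-concavity of the weight\<close>

definition ln_weight_deriv :: "real \<Rightarrow> real \<Rightarrow> real" where
  "ln_weight_deriv d k = 1 / k - 2 * d / (exp (4 * k * d) - 1)"

lemma coupling_weight_pos: "d > 0 \<Longrightarrow> k > 0 \<Longrightarrow> coupling_weight d k > 0"
  by (simp add: coupling_weight_def)

lemma ln_coupling_weight_has_derivative:
  assumes "d > 0" "k > 0"
  shows "((\<lambda>k. ln (coupling_weight d k)) has_real_derivative ln_weight_deriv d k) (at k)"
proof (rule has_field_derivative_transform_within_open[of _ _ _ "{0<..}"])
  have e: "exp (- 4 * k * d) < 1" "exp (4 * k * d) > 1" using assms by auto
  define q where "q = exp (4 * k * d)"
  have q: "q > 1" "exp (- 4 * k * d) = 1 / q" using e by (auto simp: q_def exp_minus field_simps)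
  have eq: "1 / (1 - 1 / q) * (1 / q * (4 * d)) / 2 = 2 * d / (q - 1)"
    using \<open>q > 1\<close> by (simp add: divide_simps)
  have "((\<lambda>k. 1 - exp (- 4 * k * d)) has_real_derivative exp (- 4 * k * d) * (4 * d)) (at k)"
    by (auto intro!: derivative_eq_intros)
  from DERIV_chain2[OF DERIV_ln_divide this]
  have "((\<lambda>k. ln (1 - exp (- 4 * k * d))) has_real_derivative
      1 / (1 - exp (- 4 * k * d)) * (exp (- 4 * k * d) * (4 * d))) (at k)"
    using e by simp
  from DERIV_diff[OF DERIV_ln_divide[OF \<open>k > 0\<close>] DERIV_cdivide[OF this, of 2]]
  show "((\<lambda>k. ln k - ln (1 - exp (- 4 * k * d)) / 2) has_real_derivative ln_weight_deriv d k) (at k)"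
    unfolding q(2) eq unfolding ln_weight_deriv_def q_def .
  show "ln x - ln (1 - exp (- 4 * x * d)) / 2 = ln (coupling_weight d x)" if "x \<in> {0<..}" for x
    using that assms by (simp add: coupling_weight_def ln_div ln_sqrt)
qed (use assms in auto)

lemma ln_weight_deriv_pos:
  assumes "d > 0" "k > 0"
  shows "ln_weight_deriv d k > 0"
proof -
  have "exp (4 * k * d) - 1 \<ge> 4 * k * d" using exp_ge_add_one_self[of "4 * k * d"] by linarith
  moreover have "4 * k * d = 2 * (2 * d * k)" "2 * d * k > 0" using assms by simp_all
  ultimately have "2 * d * k < exp (4 * k * d) - 1" by linarith
  then have "2 * d / (exp (4 * k * d) - 1) < 1 / k"
    using assms by (simp add: divide_simps)
  then show ?thesis by (simp add: ln_weight_deriv_def)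
qed

lemma coupling_weight_strict_mono:
  assumes "d > 0" "0 < x" "x < y"
  shows "coupling_weight d x < coupling_weight d y"
proof -
  have "ln (coupling_weight d x) < ln (coupling_weight d y)"
  proof (rule DERIV_pos_imp_increasing[OF \<open>x < y\<close>])
    fix k assume "x \<le> k" "k \<le> y"
    then show "\<exists>D. ((\<lambda>k. ln (coupling_weight d k)) has_real_derivative D) (at k) \<and> 0 < D"
      using ln_coupling_weight_has_derivative[of d k] ln_weight_deriv_pos[of d k] assms by auto
  qed
  then show ?thesis using assms coupling_weight_pos[of d] by simp
qed

text \<open>This is x < sinh x multiplied by 2 exp x. The map u -> u^2 - 2 x u increases for u >= x,
  so exp x may be replaced by its quadratic Taylor polynomial \<open>w\<close>, where the value is
  exactly 1 + x^4 / 4.\<close>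

lemma two_mult_exp_less_square_minus_1:
  fixes x :: real
  assumes "x > 0"
  shows "2 * x * exp x < (exp x)\<^sup>2 - 1"
proof -
  define u where "u = exp x"
  define w where "w = 1 + x + x\<^sup>2 / 2"
  have "u \<ge> w" using exp_lower_Taylor_quadratic[of x] assms by (simp add: u_def w_def)
  moreover have "w \<ge> 1 + x" by (simp add: w_def)
  ultimately have "(u - w) * (u + w - 2 * x) \<ge> 0" by simp
  moreover have "(u - w) * (u + w - 2 * x) = u\<^sup>2 - 2 * x * u - (w\<^sup>2 - 2 * x * w)" by algebra
  moreover have "w\<^sup>2 - 2 * x * w = 1 + x ^ 4 / 4"
    by (simp add: w_def algebra_simps power2_eq_square power4_eq_xxxx)
  moreover have "x ^ 4 > 0" using assms by simp
  ultimately have "2 * x * u < u\<^sup>2 - 1" by linarith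
  then show ?thesis by (simp add: u_def)
qed

text \<open>The weight is strictly log-concave. With u = exp (2 k d) the derivative is negative iff
  8 d^2 k^2 u^2 < (u^2 - 1)^2, and squaring the sinh inequality at 2 k d gives this even with
  16.\<close>

lemma ln_weight_deriv_strict_antimono:
  assumes "d > 0" "0 < x" "x < y"
  shows "ln_weight_deriv d y < ln_weight_deriv d x"
proof (rule DERIV_neg_imp_decreasing[OF \<open>x < y\<close>])
  fix k assume "x \<le> k" "k \<le> y"
  then have k: "k > 0" using assms by simp
  define u where "u = exp (2 * k * d)"
  have u2: "exp (4 * k * d) = u\<^sup>2" by (simp add: u_def flip: exp_of_nat_mult)
  have u: "u > 1" using k assms by (simp add: u_def)
  have der: "(ln_weight_deriv d has_real_derivative - 1 / k\<^sup>2 + 8 * d\<^sup>2 * u\<^sup>2 / (u\<^sup>2 - 1)\<^sup>2) (at k)"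
    unfolding ln_weight_deriv_def using k assms u2
    by (auto intro!: derivative_eq_intros simp: power2_eq_square field_simps)
  have "2 * (2 * k * d) * u < u\<^sup>2 - 1"
    unfolding u_def using k assms by (intro two_mult_exp_less_square_minus_1) auto
  then have "(2 * (2 * k * d) * u)\<^sup>2 < (u\<^sup>2 - 1)\<^sup>2"
    using k assms u by (intro power_strict_mono) auto
  then have "16 * d\<^sup>2 * u\<^sup>2 * k\<^sup>2 < (u\<^sup>2 - 1)\<^sup>2" by (simp add: power_mult_distrib mult_ac)
  moreover have "8 * d\<^sup>2 * u\<^sup>2 * k\<^sup>2 \<le> 16 * d\<^sup>2 * u\<^sup>2 * k\<^sup>2" by simp
  ultimately have "8 * d\<^sup>2 * u\<^sup>2 * k\<^sup>2 < (u\<^sup>2 - 1)\<^sup>2" by linarith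
  then have "8 * d\<^sup>2 * u\<^sup>2 / (u\<^sup>2 - 1)\<^sup>2 < 1 / k\<^sup>2"
    using k u by (simp add: divide_simps)
  then show "\<exists>D. (ln_weight_deriv d has_real_derivative D) (at k) \<and> D < 0"
    using der by (intro exI[of _ "- 1 / k\<^sup>2 + 8 * d\<^sup>2 * u\<^sup>2 / (u\<^sup>2 - 1)\<^sup>2"]) auto
qed

section \<open>At most two levels on G_+\<close>

lemma dist_plus_pos: "\<Omega> > 0 \<Longrightarrow> N > 0 \<Longrightarrow> dist_plus \<Omega> N k > 0"
  using root_disc_gt[of \<Omega> N k] by (simp add: dist_plus_def)

text \<open>From R' = 2 k (\<Omega> + k^2) / R the derivative of \<open>dist_plus\<close> is k
  (\<Omega> + k^2 - R) / R, a multiple of \<open>dist_plus\<close> itself.\<close>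

lemma ln_dist_plus_has_derivative:
  assumes "\<Omega> > 0" "N > 0"
  shows "((\<lambda>k. ln (dist_plus \<Omega> N k)) has_real_derivative - 2 * k / root_disc \<Omega> N k) (at k)"
proof -
  define R where "R = root_disc \<Omega> N k"
  have R: "R > \<Omega> + k\<^sup>2" using root_disc_gt[OF assms] by (simp add: R_def)
  have "(\<Omega> + k\<^sup>2)\<^sup>2 + 4 * N > 0" using assms by (simp add: add_nonneg_pos)
  then have "(root_disc \<Omega> N has_real_derivative (\<Omega> + k\<^sup>2) * (2 * k) / R) (at k)"
    unfolding root_disc_def R_def by (auto intro!: derivative_eq_intros simp: divide_simps)
  then have "(dist_plus \<Omega> N has_real_derivative ((\<Omega> + k\<^sup>2) * (2 * k) / R - 2 * k) / 2) (at k)"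
    unfolding dist_plus_def by (auto intro!: derivative_eq_intros)
  from DERIV_chain2[OF DERIV_ln_divide[OF dist_plus_pos[OF assms]] this]
  have "((\<lambda>k. ln (dist_plus \<Omega> N k)) has_real_derivative
      1 / dist_plus \<Omega> N k * (((\<Omega> + k\<^sup>2) * (2 * k) / R - 2 * k) / 2)) (at k)" .
  moreover have "R > 0" using R assms(1) zero_le_power2[of k] by argo
  then have "((\<Omega> + k\<^sup>2) * (2 * k) / R - 2 * k) / 2 = dist_plus \<Omega> N k * (- 2 * k / R)"
    by (simp add: dist_plus_def field_simps flip: R_def)
  ultimately show ?thesis using dist_plus_pos[OF assms, of k] by (simp add: R_def)
qed

text \<open>The logarithmic derivative of the coupling along \<open>G\<^sub>+\<close> is \<open>ln_weight_deriv d k - 2 k / R\<close>,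
  where \<open>R = root_disc \<Omega> N k\<close>. Its zeros satisfy \<open>2 k\<^sup>2 < R\<close>, and in that range \<open>k / R\<close> increases while \<open>ln_weight_deriv\<close> decreases.\<close>

lemma plus_critical_point_unique:
  assumes "\<Omega> > 0" "N > 0" "d > 0" "0 < x" "x < y"
    and x: "ln_weight_deriv d x = 2 * x / root_disc \<Omega> N x"
    and y: "ln_weight_deriv d y = 2 * y / root_disc \<Omega> N y"
  shows False
proof -
  define X Y where "X = x\<^sup>2" and "Y = y\<^sup>2"
  define P Q where "P = root_disc \<Omega> N x" and "Q = root_disc \<Omega> N y"
  have XY: "0 < X" "X < Y" using assms by (auto simp: X_def Y_def intro: power_strict_mono)
  have P: "P\<^sup>2 = (\<Omega> + X)\<^sup>2 + 4 * N" "P > 0" and Q: "Q\<^sup>2 = (\<Omega> + Y)\<^sup>2 + 4 * N" "Q > 0"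
    using root_disc_power2[OF \<open>N > 0\<close>] root_disc_gt[OF assms(1,2), of x] root_disc_gt[OF assms(1,2), of y]
      zero_le_power2[of x] zero_le_power2[of y] \<open>\<Omega> > 0\<close>
    unfolding P_def Q_def X_def Y_def by (blast, linarith, blast, linarith)
  have "2 * y / Q < 1 / y"
  proof -
    have "2 * d / (exp (4 * y * d) - 1) > 0" using assms by simp
    then show ?thesis using y unfolding ln_weight_deriv_def Q_def by linarith
  qed
  then have "2 * Y < Q" using assms Q by (simp add: Y_def field_simps power2_eq_square)
  then have "(2 * Y)\<^sup>2 < Q\<^sup>2" using XY by (intro power_strict_mono) auto
  then have "2 * Y\<^sup>2 < 2 * \<Omega>\<^sup>2 + 4 * N"
    using Q sum_squares_bound[of \<Omega> Y] by (simp add: power2_sum power_mult_distrib)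
  then have "Y\<^sup>2 < \<Omega>\<^sup>2 + 4 * N" using assms by simp
  moreover have "X * Y \<le> Y\<^sup>2" using XY by (simp add: power2_eq_square)
  \<comment> \<open>The identity behind the next step is Y P^2 - X Q^2 = (Y - X) (\<Omega>^2 + 4 N -
    X Y). Since X Y <= Y^2, the bound at the larger critical point alone makes it
    nonnegative.\<close>
  ultimately have "(Y - X) * (X * Y) \<le> (Y - X) * (\<Omega>\<^sup>2 + 4 * N)"
    using XY by (intro mult_left_mono) auto
  then have "X * Q\<^sup>2 \<le> Y * P\<^sup>2"
    unfolding P Q by (simp add: algebra_simps power2_eq_square)
  then have "(x * Q)\<^sup>2 \<le> (y * P)\<^sup>2" by (simp add: power_mult_distrib X_def Y_def)
  moreover have "0 \<le> y * P" using assms P by simp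
  ultimately have "x * Q \<le> y * P" by (rule power2_le_imp_le)
  then have "2 * x / P \<le> 2 * y / Q" using P Q by (simp add: field_simps)
  then show False
    using ln_weight_deriv_strict_antimono[OF assms(3-5)] x y by (simp add: P_def Q_def)
qed

lemma plus_level_no_three:
  assumes "\<Omega> > 0" "N > 0" "d > 0" "0 < x" "x < y" "y < z"
    and xy: "coupling_weight d x * dist_plus \<Omega> N x = coupling_weight d y * dist_plus \<Omega> N y"
    and yz: "coupling_weight d y * dist_plus \<Omega> N y = coupling_weight d z * dist_plus \<Omega> N z"
  shows False
proof -
  define H where "H = (\<lambda>k. ln (coupling_weight d k) + ln (dist_plus \<Omega> N k))"
  define h where "h = (\<lambda>k. ln_weight_deriv d k + - 2 * k / root_disc \<Omega> N k)"
  have H: "(H has_real_derivative h k) (at k)" if "k > 0" for k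
    unfolding H_def h_def using that assms
    by (intro DERIV_add ln_coupling_weight_has_derivative ln_dist_plus_has_derivative) auto
  have Hln: "H k = ln (coupling_weight d k * dist_plus \<Omega> N k)" if "k > 0" for k
    using that assms coupling_weight_pos[of d k] dist_plus_pos[of \<Omega> N k] by (simp add: H_def ln_mult)
  have rolle: "\<exists>c. a < c \<and> c < b \<and> h c = 0" if ab: "0 < a" "a < b" "H a = H b" for a b
  proof -
    have "\<exists>c>a. c < b \<and> (\<lambda>v. v * h c) = (\<lambda>v. 0)"
    proof (rule Rolle_deriv[OF ab(2,3)])
      show "continuous_on {a..b} H"
        by (rule DERIV_continuous_on[of _ _ h], rule has_field_derivative_at_within, rule H)
          (use ab in auto)
      show "(H has_derivative (\<lambda>v. v * h c)) (at c)" if "a < c" "c < b" for c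
        using H[of c] that ab by (simp add: has_field_derivative_def mult_commute_abs)
    qed
    then show ?thesis by (metis mult_1)
  qed
  obtain p where p: "x < p" "p < y" "h p = 0" using rolle[of x y] assms Hln[of x] Hln[of y] by auto
  obtain q where q: "y < q" "q < z" "h q = 0" using rolle[of y z] assms Hln[of y] Hln[of z] by auto
  show False
    using plus_critical_point_unique[OF assms(1-3), of p q] p q assms by (auto simp: h_def)
qed

section \<open>Existence on G_- and the final count\<close>

lemma minus_level_exists:
  assumes "\<Omega> > 0" "N > 0" "d > 0" "v > 0"
  obtains k where "k > 0" "coupling_weight d k * dist_minus \<Omega> N k = v"
proof -
  define F where "F = (\<lambda>k. coupling_weight d k * dist_minus \<Omega> N k)"
  \<comment> \<open>The quotient is 0 / 0 at k = 0 but behaves like sqrt (k / (4 d)).\<close>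
  have "(coupling_weight d \<longlongrightarrow> 0) (at_right 0)"
    unfolding coupling_weight_def using assms by real_asymp
  moreover have "isCont (dist_minus \<Omega> N) 0"
    unfolding dist_minus_def root_disc_def by (auto intro!: continuous_intros)
  then have "(dist_minus \<Omega> N \<longlongrightarrow> dist_minus \<Omega> N 0) (at_right 0)"
    by (simp add: continuous_at filterlim_at_split)
  ultimately have "(F \<longlongrightarrow> 0) (at_right 0)"
    unfolding F_def using tendsto_mult by fastforce
  then have "eventually (\<lambda>k. F k < v) (at_right 0)" using assms by (auto dest: order_tendstoD)
  then obtain b where b: "b > 0" "\<And>k. 0 < k \<Longrightarrow> k < b \<Longrightarrow> F k < v"
    unfolding eventually_at_right_field by auto
  \<comment> \<open>Here the weight is at least \<open>M\<close> and the distance at least \<Omega>,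
    so the product is at least M \<Omega> = v.\<close>
  define M where "M = v / \<Omega>"
  have M: "M > 0" using assms by (simp add: M_def)
  have "sqrt (1 - exp (- 4 * M * d)) \<le> 1" "sqrt (1 - exp (- 4 * M * d)) > 0"
    using M assms by auto
  then have "coupling_weight d M \<ge> M" using M by (simp add: coupling_weight_def field_simps)
  moreover have "dist_minus \<Omega> N M \<ge> \<Omega>"
    using root_disc_gt[OF assms(1,2), of M] zero_le_power2[of M]
    unfolding dist_minus_def by argo
  ultimately have "M * \<Omega> \<le> F M" unfolding F_def using M assms by (intro mult_mono) auto
  then have FM: "v \<le> F M" using assms by (simp add: M_def)
  define m where "m = min (b / 2) M"
  have m: "0 < m" "m \<le> M" "F m \<le> v" using b M by (auto simp: m_def intro: less_imp_le)
  have "\<exists>k. m \<le> k \<and> k \<le> M \<and> F k = v"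
  proof (rule IVT'[OF m(3) FM m(2)])
    show "continuous_on {m..M} F"
      unfolding F_def coupling_weight_def dist_minus_def root_disc_def
      using assms m by (auto intro!: continuous_intros)
  qed
  then show ?thesis using that m(1) unfolding F_def by (metis less_le_trans)
qed

lemma is_eigenvalue_iff_coupling_weight:
  assumes pos: "g > 0" "\<Omega> > 0" "\<rho> > 0" "d > 0" "\<mu> > 0" and ne: "\<omega> \<noteq> \<Omega>"
  shows "is_eigenvalue g \<Omega> \<rho> d \<mu> \<omega> \<longleftrightarrow> \<omega> \<in> G_minus g \<Omega> \<rho> \<union> G_plus g \<Omega> \<rho> \<and>
    coupling_weight d (kappa g \<Omega> \<rho> \<omega>) * \<bar>\<omega> - \<Omega>\<bar> = g\<^sup>2 * \<mu> / 2"
proof -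
  define l where "l = lam g \<Omega> \<rho> \<omega>"
  define c where "c = g\<^sup>2 * \<mu> / (\<omega> - \<Omega>)"
  define W where "W = 1 - exp (- 4 * sqrt (- l) * d)"
  have mc: "g\<^sup>2 * - \<mu> / (\<omega> - \<Omega>) = - c" by (simp add: c_def)
  have "is_eigenvalue g \<Omega> \<rho> d \<mu> \<omega> \<longleftrightarrow> l < 0 \<and> 4 * (sqrt (- l))\<^sup>2 = c\<^sup>2 * W"
  proof
    assume "is_eigenvalue g \<Omega> \<rho> d \<mu> \<omega>"
    then show "l < 0 \<and> 4 * (sqrt (- l))\<^sup>2 = c\<^sup>2 * W"
      unfolding is_eigenvalue_def two_delta_solution_def W_def l_def mc c_def[symmetric]
      using bound_state_imp_secular_equation[OF \<open>d > 0\<close>] by blast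
  next
    assume sec: "l < 0 \<and> 4 * (sqrt (- l))\<^sup>2 = c\<^sup>2 * W"
    then obtain \<psi> where "square_integrable \<psi>" "\<psi> d \<noteq> 0" "continuous_on UNIV \<psi>"
      "helmholtz_off {- d, d} l \<psi>" "delta_condition d c \<psi>" "delta_condition (- d) (- c) \<psi>"
      using secular_equation_imp_bound_state[OF \<open>d > 0\<close>] unfolding W_def by metis
    then show "is_eigenvalue g \<Omega> \<rho> d \<mu> \<omega>"
      unfolding is_eigenvalue_def two_delta_solution_def mc l_def c_def[symmetric] using ne by blast
  qed
  also have "\<dots> \<longleftrightarrow> l < 0 \<and> sqrt (- l) / sqrt W * \<bar>\<omega> - \<Omega>\<bar> = g\<^sup>2 * \<mu> / 2"
  proof (rule conj_cong[OF HOL.refl])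
    assume "l < 0"
    then have W: "W > 0" using \<open>d > 0\<close> by (simp add: W_def)
    \<comment> \<open>Only |c| survives the square root, so the sign of \<omega> - \<Omega> is lost
      and both bands obey one equation.\<close>
    have "4 * (sqrt (- l))\<^sup>2 = c\<^sup>2 * W \<longleftrightarrow> (2 * sqrt (- l))\<^sup>2 = (\<bar>c\<bar> * sqrt W)\<^sup>2"
      using W by (simp add: power_mult_distrib)
    also have "\<dots> \<longleftrightarrow> 2 * sqrt (- l) = \<bar>c\<bar> * sqrt W"
      using \<open>l < 0\<close> W by (intro power2_eq_iff_nonneg) auto
    also have "\<bar>c\<bar> = g\<^sup>2 * \<mu> / \<bar>\<omega> - \<Omega>\<bar>" using pos by (simp add: c_def abs_mult)
    also have "2 * sqrt (- l) = g\<^sup>2 * \<mu> / \<bar>\<omega> - \<Omega>\<bar> * sqrt W \<longleftrightarrow>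
        sqrt (- l) / sqrt W * \<bar>\<omega> - \<Omega>\<bar> = g\<^sup>2 * \<mu> / 2"
    proof -
      define s where "s = \<bar>\<omega> - \<Omega>\<bar>"
      have "s > 0" "sqrt W > 0" using ne W by (auto simp: s_def)
      then show ?thesis unfolding s_def[symmetric] by (simp add: field_simps)
    qed
    finally show "4 * (sqrt (- l))\<^sup>2 = c\<^sup>2 * W \<longleftrightarrow>
      sqrt (- l) / sqrt W * \<bar>\<omega> - \<Omega>\<bar> = g\<^sup>2 * \<mu> / 2" .
  qed
  finally show ?thesis
    using lam_neg_iff[OF pos(1-3) ne] by (simp add: coupling_weight_def kappa_def W_def l_def)
qed

text \<open>A set that is infinite or has more than two elements contains three distinct ones, which
  can be sorted. Finiteness is stated separately because \<open>card\<close> is 0 on infinite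
  sets.\<close>

lemma finite_card_le_2:
  fixes K :: "'a :: linorder set"
  assumes "\<And>x y z. x \<in> K \<Longrightarrow> y \<in> K \<Longrightarrow> z \<in> K \<Longrightarrow> x < y \<Longrightarrow> y < z \<Longrightarrow> False"
  shows "finite K \<and> card K \<le> 2"
proof (rule ccontr)
  assume "\<not> ?thesis"
  then obtain B where B: "B \<subseteq> K" "card B = 3"
    by (metis infinite_arbitrarily_large obtain_subset_with_card_n not_less_eq_eq numeral_2_eq_2 numeral_3_eq_3)
  then obtain x y z where "{x, y, z} \<subseteq> K" "x \<noteq> y" "y \<noteq> z" "x \<noteq> z"
    by (auto simp: card_3_iff)
  then show False
    using assms by (metis insert_subset linorder_neqE)
qed

theorem mainTheorem4:
  fixes g \<Omega> \<rho>\<^sub>0 d \<mu> :: real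
  assumes "g > 0" and "\<Omega> > 0" and "\<rho>\<^sub>0 > 0" and "d > 0" and "\<mu> > 0"
  shows "(\<forall>\<omega>::real. \<omega> \<noteq> \<Omega> \<longrightarrow>
            (is_eigenvalue g \<Omega> \<rho>\<^sub>0 d \<mu> \<omega> \<longleftrightarrow>
               \<omega> \<in> G_minus g \<Omega> \<rho>\<^sub>0 \<union> G_plus g \<Omega> \<rho>\<^sub>0 \<and>
               \<mu> = 2 * kappa g \<Omega> \<rho>\<^sub>0 \<omega> * \<bar>\<omega> - \<Omega>\<bar> /
                   (g\<^sup>2 * sqrt (1 - exp (- 4 * kappa g \<Omega> \<rho>\<^sub>0 \<omega> * d)))))
       \<and> (\<exists>!\<omega>. \<omega> \<in> G_minus g \<Omega> \<rho>\<^sub>0 \<and> is_eigenvalue g \<Omega> \<rho>\<^sub>0 d \<mu> \<omega>)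
       \<and> finite {\<omega> \<in> G_plus g \<Omega> \<rho>\<^sub>0. is_eigenvalue g \<Omega> \<rho>\<^sub>0 d \<mu> \<omega>}
       \<and> card {\<omega> \<in> G_plus g \<Omega> \<rho>\<^sub>0. is_eigenvalue g \<Omega> \<rho>\<^sub>0 d \<mu> \<omega>} \<in> {0, 1, 2}"
proof -
  define N where "N = g\<^sup>2 * \<rho>\<^sub>0"
  define v where "v = g\<^sup>2 * \<mu> / 2"
  have N: "N > 0" and v: "v > 0" using assms by (auto simp: N_def v_def)
  note eig = is_eigenvalue_iff_coupling_weight[OF assms, folded v_def]
  have "\<mu> = 2 * k * s / (g\<^sup>2 * r) \<longleftrightarrow> k / r * s = v" if "r > 0" for k s r :: real
    using that assms by (auto simp: v_def field_simps)
  then have "is_eigenvalue g \<Omega> \<rho>\<^sub>0 d \<mu> \<omega> \<longleftrightarrow> \<omega> \<in> G_minus g \<Omega> \<rho>\<^sub>0 \<union> G_plus g \<Omega> \<rho>\<^sub>0 \<and>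
      \<mu> = 2 * kappa g \<Omega> \<rho>\<^sub>0 \<omega> * \<bar>\<omega> - \<Omega>\<bar> / (g\<^sup>2 * sqrt (1 - exp (- 4 * kappa g \<Omega> \<rho>\<^sub>0 \<omega> * d)))"
    if "\<omega> \<noteq> \<Omega>" for \<omega>
    unfolding eig[OF that] coupling_weight_def
    using kappa_pos(1)[OF assms(1-3) that] \<open>d > 0\<close> by (intro conj_cong HOL.refl) simp
  moreover have "\<exists>!\<omega>. \<omega> \<in> G_minus g \<Omega> \<rho>\<^sub>0 \<and> is_eigenvalue g \<Omega> \<rho>\<^sub>0 d \<mu> \<omega>"
  proof -
    obtain k where k: "k > 0" "coupling_weight d k * dist_minus \<Omega> N k = v"
      using minus_level_exists[OF \<open>\<Omega> > 0\<close> N \<open>d > 0\<close> v] .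
    note om = dist_minus_in_G_minus[OF assms(1-3) k(1), folded N_def]
    show ?thesis
    proof (rule ex1I[of _ "\<Omega> - dist_minus \<Omega> N k"])
      show "\<Omega> - dist_minus \<Omega> N k \<in> G_minus g \<Omega> \<rho>\<^sub>0 \<and>
          is_eigenvalue g \<Omega> \<rho>\<^sub>0 d \<mu> (\<Omega> - dist_minus \<Omega> N k)"
        using eig[of "\<Omega> - dist_minus \<Omega> N k"] om k by simp
    next
      fix \<omega> assume \<omega>: "\<omega> \<in> G_minus g \<Omega> \<rho>\<^sub>0 \<and> is_eigenvalue g \<Omega> \<rho>\<^sub>0 d \<mu> \<omega>"
      define k' where "k' = kappa g \<Omega> \<rho>\<^sub>0 \<omega>"
      have less: "\<omega> < \<Omega>" using G_minus_less assms \<omega> by blast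
      have dist: "\<Omega> - \<omega> = dist_minus \<Omega> N k'"
        unfolding k'_def N_def using dist_minus_kappa assms \<omega> by blast
      have k': "k' > 0" using kappa_pos(1)[OF assms(1-3), of \<omega>] less \<omega> by (simp add: k'_def)
      have "coupling_weight d k' * \<bar>\<omega> - \<Omega>\<bar> = v" using eig[of \<omega>] less \<omega> by (simp add: k'_def)
      then have level: "coupling_weight d k' * dist_minus \<Omega> N k' = v" using less dist by simp
      have mono: "coupling_weight d x * dist_minus \<Omega> N x < coupling_weight d y * dist_minus \<Omega> N y"
        if "0 < x" "x < y" for x y
        using that assms N coupling_weight_strict_mono[of d x y] dist_minus_strict_mono[of \<Omega> N x y]
          coupling_weight_pos[of d x] dist_minus_in_G_minus(1)[OF assms(1-3) that(1), folded N_def]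
        by (intro mult_strict_mono) auto
      have "k' = k" using mono[of k k'] mono[of k' k] k k' level by (cases k k' rule: linorder_cases) auto
      then show "\<omega> = \<Omega> - dist_minus \<Omega> N k" using dist by simp
    qed
  qed
  moreover have "finite Z \<and> card Z \<le> 2"
    if "Z = {\<omega> \<in> G_plus g \<Omega> \<rho>\<^sub>0. is_eigenvalue g \<Omega> \<rho>\<^sub>0 d \<mu> \<omega>}" for Z
  proof -
    have Z: "kappa g \<Omega> \<rho>\<^sub>0 \<omega> > 0" "\<omega> - \<Omega> = dist_plus \<Omega> N (kappa g \<Omega> \<rho>\<^sub>0 \<omega>)"
      "coupling_weight d (kappa g \<Omega> \<rho>\<^sub>0 \<omega>) * dist_plus \<Omega> N (kappa g \<Omega> \<rho>\<^sub>0 \<omega>) = v" if "\<omega> \<in> Z" for \<omega>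
    proof -
      have \<omega>: "\<omega> > \<Omega>" "\<omega> \<in> G_plus g \<Omega> \<rho>\<^sub>0" "is_eigenvalue g \<Omega> \<rho>\<^sub>0 d \<mu> \<omega>"
        using that \<open>Z = _\<close> by (auto simp: G_plus_def)
      show "kappa g \<Omega> \<rho>\<^sub>0 \<omega> > 0" using kappa_pos(1)[OF assms(1-3), of \<omega>] \<omega> by simp
      show dist: "\<omega> - \<Omega> = dist_plus \<Omega> N (kappa g \<Omega> \<rho>\<^sub>0 \<omega>)"
        unfolding N_def using dist_plus_kappa assms \<omega> by blast
      show "coupling_weight d (kappa g \<Omega> \<rho>\<^sub>0 \<omega>) * dist_plus \<Omega> N (kappa g \<Omega> \<rho>\<^sub>0 \<omega>) = v"
        using eig[of \<omega>] \<omega> unfolding dist[symmetric] by simp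
    qed
    \<comment> \<open>Since \<omega> - \<Omega> is a function of \<kappa>, counting values of
      \<kappa> counts eigenvalues.\<close>
    have "inj_on (kappa g \<Omega> \<rho>\<^sub>0) Z"
      by (rule inj_onI) (metis Z(2) diff_add_cancel)
    moreover have "finite (kappa g \<Omega> \<rho>\<^sub>0 ` Z) \<and> card (kappa g \<Omega> \<rho>\<^sub>0 ` Z) \<le> 2"
    proof (rule finite_card_le_2)
      fix x y z
      assume "x \<in> kappa g \<Omega> \<rho>\<^sub>0 ` Z" "y \<in> kappa g \<Omega> \<rho>\<^sub>0 ` Z" "z \<in> kappa g \<Omega> \<rho>\<^sub>0 ` Z" "x < y" "y < z"
      then show False
        using plus_level_no_three[OF \<open>\<Omega> > 0\<close> N \<open>d > 0\<close>, of x y z] Z(1,3) by auto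
    qed
    ultimately show ?thesis by (simp add: card_image finite_image_iff)
  qed
  then have "finite {\<omega> \<in> G_plus g \<Omega> \<rho>\<^sub>0. is_eigenvalue g \<Omega> \<rho>\<^sub>0 d \<mu> \<omega>}"
    "card {\<omega> \<in> G_plus g \<Omega> \<rho>\<^sub>0. is_eigenvalue g \<Omega> \<rho>\<^sub>0 d \<mu> \<omega>} \<le> 2" by blast+
  moreover have "n \<in> {0, 1, 2}" if "n \<le> 2" for n :: nat using that by auto
  ultimately show ?thesis by blast
qed

end
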